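(* For a parameter $t>0$, let $(X_{j,k})_{j,k\ge1}$ be independent random variables with $\mathbb{P}_t(X_{j,k}=m)=(1-e^{-jk(j+k)t/2})e^{-jk(j+k)mt/2}$ for $m\ge0$, let $N=\sum_{j,k\ge1}\tfrac12jk(j+k)X_{j,k}$, and $\phi_t(u)=\mathbb{E}_t(e^{iuN})$. Let $X=\left(\tfrac19\Gamma(\tfrac13)^2\zeta(\tfrac53)\right)^{3/10}$, $Y=-\sqrt\pi\,\zeta(\tfrac12)\zeta(\tfrac32)$, $\tau_1=2X^2$, $\tau_2=\tfrac{3}{10}X^{-1}Y$, $\tau_3=\tfrac{3}{400}X^{-4}Y^2$, $t_n=\tau_1n^{-3/5}-\tau_2n^{-7/10}-\tau_3n^{-4/5}$, and $\sigma_n=(\operatorname{Var}_{t_n}(N))^{1/2}$. Let $D>0$ be a constant such that $|\phi_{t_n}(u/\sigma_n)|\le e^{-u^2/4}$ for all sufficiently large $n$ and all $|u|\le Dn^{1/5}$. Then there exists a constant $E>0$ such that for all sufficiently large $n$ and all $u$ with $Dn^{1/5}\le|u|\le\pi\sigma_n$, $$|\phi_{t_n}(u/\sigma_n)|\le\exp\!\left(-En^{3/10}\right).$$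
   Context: $\mathbb{E}_t$, $\operatorname{Var}_t$ denote expectation and variance in the model with parameter $t$; such a constant $D$ exists. *)

theory Defs
  imports "HOL-Probability.Probability" "HOL-Complex_Analysis.Complex_Analysis"
begin

(* Analytic continuation of the Dirichlet series. Existence, and uniqueness away from the
   pole 1, are riemann_zeta_exists and riemann_zeta_unique below. *)
definition riemann_zeta :: "complex \<Rightarrow> complex" where
  "riemann_zeta = (SOME f. f holomorphic_on (- {1}) \<and>
     (\<forall>s. Re s > 1 \<longrightarrow> (\<lambda>n. 1 / of_nat (Suc n) powr s) sums f s))"

(* Taking the real part only changes the type: see of_real_zeta_real below. *)
definition zeta_real :: "real \<Rightarrow> real" where
  "zeta_real x = Re (riemann_zeta (of_real x))"

definition pos_pairs :: "(nat \<times> nat) set" where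
  "pos_pairs = {1..} \<times> {1..}"

definition weight :: "nat \<Rightarrow> nat \<Rightarrow> real" where
  "weight j k = real j * real k * (real j + real k) / 2"

definition geometric_model ::
    "real \<Rightarrow> 'a measure \<Rightarrow> (nat \<Rightarrow> nat \<Rightarrow> 'a \<Rightarrow> nat) \<Rightarrow> bool" where
  "geometric_model t M X \<longleftrightarrow>
     prob_space M \<and>
     prob_space.indep_vars M (\<lambda>_. count_space UNIV) (\<lambda>(j, k). X j k) pos_pairs \<and>
     (\<forall>j\<ge>1. \<forall>k\<ge>1. \<forall>m.
        measure M {\<omega> \<in> space M. X j k \<omega> = m} =
          (1 - exp (- (weight j k * t))) * exp (- (weight j k * real m * t)))"

(* The sum is finite almost surely when t > 0; on the exceptional null set infsum is 0. *)
definition sum_N :: "(nat \<Rightarrow> nat \<Rightarrow> 'a \<Rightarrow> nat) \<Rightarrow> 'a \<Rightarrow> real" where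
  "sum_N X \<omega> = (\<Sum>\<^sub>\<infinity>(j, k)\<in>pos_pairs. weight j k * real (X j k \<omega>))"

definition phi :: "'a measure \<Rightarrow> (nat \<Rightarrow> nat \<Rightarrow> 'a \<Rightarrow> nat) \<Rightarrow> real \<Rightarrow> complex" where
  "phi M X u = (CLINT \<omega>|M. exp (\<i> * of_real (u * sum_N X \<omega>)))"

definition const_X :: real where
  "const_X = (1 / 9 * Gamma (1 / 3) ^ 2 * zeta_real (5 / 3)) powr (3 / 10)"

definition const_Y :: real where
  "const_Y = - sqrt pi * zeta_real (1 / 2) * zeta_real (3 / 2)"

definition tau1 :: real where "tau1 = 2 * const_X ^ 2"

definition tau2 :: real where "tau2 = 3 / 10 * const_X powi (-1) * const_Y"

definition tau3 :: real where "tau3 = 3 / 400 * const_X powi (-4) * const_Y ^ 2"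

definition t_seq :: "nat \<Rightarrow> real" where
  "t_seq n = tau1 * real n powr (- 3 / 5) - tau2 * real n powr (- 7 / 10)
             - tau3 * real n powr (- 4 / 5)"

definition sigma_seq ::
    "(real \<Rightarrow> 'a measure) \<Rightarrow> (nat \<Rightarrow> nat \<Rightarrow> 'a \<Rightarrow> nat) \<Rightarrow> nat \<Rightarrow> real" where
  "sigma_seq P X n = sqrt (prob_space.variance (P (t_seq n)) (sum_N X))"

lemma open_right_halfplane: "open {s. Re s > c}"
  by (simp add: open_halfspace_Re_gt)

lemma halfplane_series:
  fixes g :: "nat \<Rightarrow> complex \<Rightarrow> complex" and C :: "complex \<Rightarrow> real"
  assumes hol: "\<And>n. g n holomorphic_on {s. Re s > c}"
    and bd: "\<And>n s. Re s > c \<Longrightarrow> norm (g n s) \<le> C s * real (Suc n) powr (- Re s - b)"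
    and C: "continuous_on {s. Re s > c} C"
    and cb: "c + b \<ge> 1"
  shows "(\<lambda>s. \<Sum>n. g n s) holomorphic_on {s. Re s > c}"
    and "\<And>s. Re s > c \<Longrightarrow> summable (\<lambda>n. g n s)"
proof -
  have sumpow: "summable (\<lambda>n. real (Suc n) powr (- r - b))" if "r > c" for r
    using that cb by (subst summable_Suc_iff, subst summable_real_powr_iff) auto
  show "summable (\<lambda>n. g n s)" if "Re s > c" for s
    by (rule summable_comparison_test'[OF summable_mult[OF sumpow[OF that]]]) (rule bd[OF that])
  show "(\<lambda>s. \<Sum>n. g n s) holomorphic_on {s. Re s > c}"
  proof (rule holomorphic_uniform_sequence[where f = "\<lambda>n s. \<Sum>i<n. g i s"])
    show "open {s. Re s > c}" by (rule open_right_halfplane)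
    show "(\<lambda>s. \<Sum>i<n. g i s) holomorphic_on {s. Re s > c}" for n
      by (intro holomorphic_on_sum hol)
    fix x assume x: "x \<in> {s. Re s > c}"
    define d where "d = (Re x - c) / 2"
    define r where "r = Re x - d"
    have d: "d > 0" "r > c" using x by (auto simp: d_def r_def field_simps)
    have Rer: "Re y \<ge> r" if "y \<in> cball x d" for y
      using that abs_Re_le_cmod[of "x - y"] by (auto simp: r_def dist_norm)
    have sub: "cball x d \<subseteq> {s. Re s > c}"
      using Rer d by force
    have "compact (C ` cball x d)"
      by (rule compact_continuous_image[OF continuous_on_subset[OF C sub]]) simp
    then obtain B where B: "\<And>y. y \<in> cball x d \<Longrightarrow> norm (C y) \<le> B"
      using compact_imp_bounded[of "C ` cball x d"] unfolding bounded_iff by blast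
    have "uniform_limit (cball x d) (\<lambda>n s. \<Sum>i<n. g i s) (\<lambda>s. \<Sum>i. g i s) sequentially"
    proof (rule Weierstrass_m_test)
      show "summable (\<lambda>n. B * real (Suc n) powr (- r - b))"
        by (intro summable_mult sumpow d)
      fix n y assume y: "y \<in> cball x d"
      have "norm (g n y) \<le> C y * real (Suc n) powr (- Re y - b)"
        using bd sub y by auto
      also have "\<dots> \<le> B * real (Suc n) powr (- r - b)"
        using B[OF y] Rer[OF y] by (intro mult_mono powr_mono) auto
      finally show "norm (g n y) \<le> B * real (Suc n) powr (- r - b)" .
    qed
    then show "\<exists>d>0. cball x d \<subseteq> {s. Re s > c} \<and>
        uniform_limit (cball x d) (\<lambda>n s. \<Sum>i<n. g i s) (\<lambda>s. \<Sum>i. g i s) sequentially"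
      using d sub by blast
  qed
qed

definition dirichlet_zeta :: "complex \<Rightarrow> complex" where
  "dirichlet_zeta s = (\<Sum>n. 1 / of_nat (Suc n) powr s)"

lemma dirichlet_zeta:
  shows "dirichlet_zeta holomorphic_on {s. Re s > 1}"
    and "\<And>s. Re s > 1 \<Longrightarrow> summable (\<lambda>n. 1 / of_nat (Suc n) powr s :: complex)"
proof -
  have n: "norm (1 / of_nat (Suc n) powr s :: complex) \<le> 1 * real (Suc n) powr (- Re s - 0)"
    for n s
  proof -
    have "norm (of_nat (Suc n) powr s) = real (Suc n) powr Re s"
      by (subst norm_powr_real_powr) (auto simp del: of_nat_Suc)
    then show ?thesis by (simp add: norm_divide powr_minus divide_simps del: of_nat_Suc)
  qed
  have h: "(\<lambda>s. 1 / of_nat (Suc n) powr s :: complex) holomorphic_on A" for n A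
    by (intro holomorphic_intros) (auto simp del: of_nat_Suc)
  show "dirichlet_zeta holomorphic_on {s. Re s > 1}"
    unfolding dirichlet_zeta_def
    by (rule halfplane_series(1)[where C = "\<lambda>_. 1" and b = 0]) (use n h in auto)
  show "summable (\<lambda>n. 1 / of_nat (Suc n) powr s :: complex)" if "Re s > 1" for s
    by (rule halfplane_series(2)[where c = 1 and C = "\<lambda>_. 1" and b = 0]) (use n h that in auto)
qed

definition taylor_rem :: "nat \<Rightarrow> nat \<Rightarrow> complex \<Rightarrow> complex" where
  "taylor_rem K n s = of_nat (Suc (Suc n)) powr (1 - s) -
     (\<Sum>m\<le>K. ((1 - s) gchoose m) * of_nat (Suc n) powr (1 - s - of_nat m))"

lemma holomorphic_gbinomial:
  fixes f :: "complex \<Rightarrow> complex"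
  assumes "f holomorphic_on A"
  shows "(\<lambda>s. f s gchoose m) holomorphic_on A"
proof -
  have *: "(f s gchoose m) = (\<Prod>i=0..<m. f s - of_nat i) / fact m" for s
    by (simp add: gbinomial_prod_rev)
  show ?thesis unfolding * by (intro holomorphic_intros assms) auto
qed

lemma taylor_rem_bound:
  assumes "Re s > - real K"
  shows "norm (taylor_rem K n s) \<le>
    norm (fact (Suc K) * ((1 - s) gchoose (Suc K)) / fact K) * real (Suc n) powr (- Re s - real K)"
proof -
  define f where "f = (\<lambda>i (x::complex). fact i * ((1 - s) gchoose i) * x powr (1 - s - of_nat i))"
  define w z where "w = (of_nat (Suc n) :: complex)" and "z = (of_nat (Suc (Suc n)) :: complex)"
  define S where "S = closed_segment w z"
  define B where "B = norm (fact (Suc K) * ((1 - s) gchoose (Suc K))) * real (Suc n) powr (- Re s - real K)"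
  have S: "\<exists>y. x = of_real y \<and> y \<ge> real (Suc n)" if "x \<in> S" for x
  proof -
    from that obtain u where u: "0 \<le> u" "u \<le> 1" "x = (1 - u) *\<^sub>R w + u *\<^sub>R z"
      by (auto simp: S_def closed_segment_def)
    then have "x = of_real (real (Suc n) + u)"
      by (simp add: w_def z_def scaleR_conv_of_real algebra_simps)
    with u show ?thesis by (intro exI[of _ "real (Suc n) + u"]) auto
  qed
  have zw: "z - w = 1" by (simp add: z_def w_def)
  have "norm (f 0 z - (\<Sum>i\<le>K. f i w * (z - w) ^ i / fact i)) \<le> B * norm (z - w) ^ Suc K / fact K"
  proof (rule complex_Taylor[of S])
    show "convex S" "w \<in> S" "z \<in> S" by (auto simp: S_def)
    fix x assume x: "x \<in> S"
    obtain y where y: "x = of_real y" "y \<ge> real (Suc n)" using S[OF x] by blast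
    have ypos: "y > 0" using y by (auto intro: less_le_trans[of 0 "real (Suc n)"] simp del: of_nat_Suc)
    have x0: "x \<notin> \<real>\<^sub>\<le>\<^sub>0" using y ypos by (auto simp: complex_nonpos_Reals_iff)
    show "norm (f (Suc K) x) \<le> B"
    proof -
      have "norm (x powr (1 - s - of_nat (Suc K))) = y powr (- Re s - real K)"
        using ypos unfolding y(1) by (subst norm_powr_real_powr) auto
      also have "\<dots> \<le> real (Suc n) powr (- Re s - real K)"
        using y assms by (intro powr_mono2') (auto simp del: of_nat_Suc)
      finally show ?thesis unfolding f_def B_def norm_mult
        by (intro mult_left_mono) auto
    qed
    fix i :: nat
    have g: "fact (Suc i) * ((1 - s) gchoose (Suc i)) = fact i * ((1 - s) gchoose i) * (1 - s - of_nat i)"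
      by (simp only: gbinomial_mult_fact prod.atLeast0_lessThan_Suc)
    have "(f i has_field_derivative fact i * ((1 - s) gchoose i) *
        ((1 - s - of_nat i) * x powr (1 - s - of_nat i - 1))) (at x within S)"
      unfolding f_def using x0 
      by (intro DERIV_cmult has_field_derivative_at_within[OF has_field_derivative_powr]) 
    moreover have "fact i * ((1 - s) gchoose i) *
        ((1 - s - of_nat i) * x powr (1 - s - of_nat i - 1)) = f (Suc i) x"
      unfolding f_def g by (simp add: algebra_simps)
    ultimately show "(f i has_field_derivative f (Suc i) x) (at x within S)" by simp
  qed
  moreover have "f 0 z - (\<Sum>i\<le>K. f i w * (z - w) ^ i / fact i) = taylor_rem K n s"
    unfolding zw by (simp add: taylor_rem_def f_def z_def w_def)
  moreover have "B * norm (z - w) ^ Suc K / fact K = 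
     norm (fact (Suc K) * ((1 - s) gchoose (Suc K)) / fact K) * real (Suc n) powr (- Re s - real K)"
    unfolding zw B_def norm_divide by (simp del: fact_Suc of_nat_Suc)
  ultimately show ?thesis by metis
qed

lemma taylor_rem_series:
  shows "(\<lambda>s. \<Sum>n. taylor_rem K n s) holomorphic_on {s. Re s > 1 - real K}"
    and "\<And>s. Re s > 1 - real K \<Longrightarrow> summable (\<lambda>n. taylor_rem K n s)"
proof -
  define C where "C = (\<lambda>s. norm (fact (Suc K) * ((1 - s) gchoose (Suc K)) / fact K :: complex))"
  have hol: "taylor_rem K n holomorphic_on A" for n A
    unfolding taylor_rem_def
    by (intro holomorphic_intros holomorphic_gbinomial) (auto simp del: of_nat_Suc)
  have C: "continuous_on A C" for A
    unfolding C_def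
    by (intro continuous_intros holomorphic_on_imp_continuous_on holomorphic_gbinomial holomorphic_intros) auto
  have bd: "norm (taylor_rem K n s) \<le> C s * real (Suc n) powr (- Re s - real K)"
    if "Re s > 1 - real K" for n s
    unfolding C_def by (rule taylor_rem_bound) (use that in auto)
  show "(\<lambda>s. \<Sum>n. taylor_rem K n s) holomorphic_on {s. Re s > 1 - real K}"
    by (rule halfplane_series(1)[OF hol bd C]) auto
  show "summable (\<lambda>n. taylor_rem K n s)" if "Re s > 1 - real K" for s
    by (rule halfplane_series(2)[OF hol bd C]) (use that in auto)
qed

lemma taylor_rem_sum:
  assumes s: "Re s > 1"
  shows "(\<Sum>n. taylor_rem (Suc k) n s) = - 1 + (s - 1) * dirichlet_zeta s -
    (\<Sum>i=1..k. ((1 - s) gchoose Suc i) * dirichlet_zeta (s + of_nat i))"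
proof -
  have lim: "(\<lambda>n. of_nat (Suc n) powr (1 - s) :: complex) \<longlonglongrightarrow> 0"
  proof (rule tendsto_norm_zero_cancel)
    have "norm (of_nat (Suc n) powr (1 - s) :: complex) = real (Suc n) powr (1 - Re s)" for n
      by (subst norm_powr_real_powr) (auto simp del: of_nat_Suc)
    moreover have "(\<lambda>n. real (Suc n) powr (1 - Re s)) \<longlonglongrightarrow> 0"
      using s by (intro tendsto_neg_powr filterlim_compose[OF filterlim_real_sequentially filterlim_Suc]) auto
    ultimately show "(\<lambda>n. norm (of_nat (Suc n) powr (1 - s) :: complex)) \<longlonglongrightarrow> 0"
      by simp
  qed
  have tel: "(\<lambda>n. of_nat (Suc (Suc n)) powr (1 - s) - of_nat (Suc n) powr (1 - s) :: complex) sums (-1)"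
    using telescope_sums[OF lim] by simp
  have Z: "(\<lambda>n. 1 / of_nat (Suc n) powr (s + of_nat i)) sums dirichlet_zeta (s + of_nat i)" for i
    unfolding dirichlet_zeta_def
    by (intro summable_sums dirichlet_zeta(2)) (use s in auto)
  have "(\<lambda>n. (of_nat (Suc (Suc n)) powr (1 - s) - of_nat (Suc n) powr (1 - s)) -
      (\<Sum>i\<le>k. ((1 - s) gchoose Suc i) * (1 / of_nat (Suc n) powr (s + of_nat i)))) sums
      (-1 - (\<Sum>i\<le>k. ((1 - s) gchoose Suc i) * dirichlet_zeta (s + of_nat i)))"
    by (intro sums_diff tel sums_sum sums_mult Z)
  also have "(\<lambda>n. (of_nat (Suc (Suc n)) powr (1 - s) - of_nat (Suc n) powr (1 - s)) -
      (\<Sum>i\<le>k. ((1 - s) gchoose Suc i) * (1 / of_nat (Suc n) powr (s + of_nat i)))) =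
      (\<lambda>n. taylor_rem (Suc k) n s)"
  proof
    fix n
    have p: "of_nat (Suc n) powr (1 - s - of_nat (Suc i)) = 1 / of_nat (Suc n) powr (s + of_nat i)" 
      for i :: nat
    proof -
      have "1 - s - of_nat (Suc i) = - (s + of_nat i)" by simp
      then show ?thesis by (simp only: powr_minus inverse_eq_divide)
    qed
    show "(of_nat (Suc (Suc n)) powr (1 - s) - of_nat (Suc n) powr (1 - s)) -
      (\<Sum>i\<le>k. ((1 - s) gchoose Suc i) * (1 / of_nat (Suc n) powr (s + of_nat i))) = taylor_rem (Suc k) n s"
      unfolding taylor_rem_def sum.atMost_Suc_shift p
      by (simp del: of_nat_Suc)
  qed
  finally have "(\<Sum>n. taylor_rem (Suc k) n s) =
    -1 - (\<Sum>i\<le>k. ((1 - s) gchoose Suc i) * dirichlet_zeta (s + of_nat i))"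
    by (rule sums_unique[symmetric])
  also have "{..k} = insert 0 {1..k}" by auto
  finally show ?thesis by (simp add: algebra_simps)
qed

lemma zeta_step:
  "\<exists>h. h holomorphic_on {s. Re s > 1 - real k} \<and>
       (\<forall>s. Re s > 1 \<longrightarrow> h s = (s - 1) * dirichlet_zeta s)"
proof (induction k)
  case 0
  show ?case
    by (rule exI[of _ "\<lambda>s. (s - 1) * dirichlet_zeta s"])
       (auto intro!: holomorphic_intros dirichlet_zeta)
next
  case (Suc k)
  then obtain h where h: "h holomorphic_on {s. Re s > 1 - real k}"
    "\<And>s. Re s > 1 \<Longrightarrow> h s = (s - 1) * dirichlet_zeta s" by blast
  define h' where "h' = (\<lambda>s. 1 - (\<Sum>i=1..k. ((1 - s) gchoose i) / of_nat (Suc i) * h (s + of_nat i)) +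
     (\<Sum>n. taylor_rem (Suc k) n s))"
  have hi: "(\<lambda>s. h (s + of_nat i)) holomorphic_on {s. Re s > 1 - real (Suc k)}" if "i \<ge> 1" for i
    using that
    by (intro holomorphic_on_compose_gen[OF _ h(1), unfolded o_def] holomorphic_intros) auto
  have "h' holomorphic_on {s. Re s > 1 - real (Suc k)}"
    unfolding h'_def
    by (intro holomorphic_intros holomorphic_gbinomial hi taylor_rem_series(1)) (auto simp del: of_nat_Suc)
  moreover have "h' s = (s - 1) * dirichlet_zeta s" if s: "Re s > 1" for s
  proof -
    have "((1 - s) gchoose Suc i) * dirichlet_zeta (s + of_nat i) =
       - (((1 - s) gchoose i) / of_nat (Suc i) * h (s + of_nat i))" for i
    proof -
      have 1: "h (s + of_nat i) = (s + of_nat i - 1) * dirichlet_zeta (s + of_nat i)"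
        using s by (intro h(2)) auto
      have 2: "of_nat (Suc i) * ((1 - s) gchoose Suc i) = (1 - s - of_nat i) * ((1 - s) gchoose i)"
        using gbinomial_absorb_comp[of "1 - s" i] gbinomial_absorption[of i "1 - s"]
        by (simp only:)
      then have 2: "((1 - s) gchoose Suc i) = (1 - s - of_nat i) * ((1 - s) gchoose i) / of_nat (Suc i)"
        by (metis nonzero_mult_div_cancel_left of_nat_neq_0)
      have 3: "1 - s - of_nat i = - (s + of_nat i - 1)" by simp
      have "(- p * g / q) * z = - (g / q * (p * z))" for p g q z :: complex
        by simp
      then show ?thesis unfolding 1 2 3 .
    qed
    then show ?thesis
      unfolding h'_def taylor_rem_sum[OF s] by (simp add: sum_negf del: of_nat_Suc)
  qed
  ultimately show ?case by blast
qed

lemma riemann_zeta_exists: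
  "\<exists>f. f holomorphic_on (- {1}) \<and>
     (\<forall>s. Re s > 1 \<longrightarrow> (\<lambda>n. 1 / of_nat (Suc n) powr s) sums f s)"
proof -
  define H where "H = (\<lambda>k. {s. Re s > 1 - real k})"
  obtain h where h: "\<And>k. h k holomorphic_on H k"
    "\<And>k s. Re s > 1 \<Longrightarrow> h k s = (s - 1) * dirichlet_zeta s"
    using zeta_step unfolding H_def by metis
  have conn: "connected (H k)" for k
    unfolding H_def by (intro convex_connected convex_halfspace_Re_gt)
  have opn: "open (H k)" for k
    unfolding H_def by (rule open_right_halfplane)
  have mono: "h k s = h l s" if "k \<le> l" "s \<in> H k" for k l s
  proof (rule analytic_continuation_open[of "{s. Re s > 1}" "H k" "h k" "h l" s])
    have sub: "H k \<subseteq> H l" using that(1) by (auto simp: H_def)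
    show "{s. Re s > 1} \<noteq> {}" by (auto intro!: exI[of _ 2])
    show "{s. Re s > 1} \<subseteq> H k" by (auto simp: H_def)
    show "h l holomorphic_on H k" by (rule holomorphic_on_subset[OF h(1) sub])
  qed (use h conn opn that open_right_halfplane in auto)
  have consist: "h k s = h l s" if "s \<in> H k" "s \<in> H l" for k l s
    using mono that by (metis nle_le)
  define K where "K = (\<lambda>s. SOME k. s \<in> H k)"
  have K: "s \<in> H (K s)" for s
  proof -
    obtain k :: nat where "real k > 1 - Re s" using reals_Archimedean2 by blast
    then have "s \<in> H k" by (simp add: H_def)
    then show ?thesis unfolding K_def by (rule someI[of "\<lambda>k. s \<in> H k"])
  qed
  define f where "f = (\<lambda>s. h (K s) s / (s - 1))"
  have "f holomorphic_on (\<Union>k. H k - {1})"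
  proof (rule holomorphic_on_UN_open)
    show "f holomorphic_on H k - {1}" for k
    proof (rule holomorphic_transform)
      show "(\<lambda>s. h k s / (s - 1)) holomorphic_on H k - {1}"
        by (intro holomorphic_intros holomorphic_on_subset[OF h(1)]) auto
      show "h k s / (s - 1) = f s" if "s \<in> H k - {1}" for s
        using consist[OF _ K, of s k] that by (simp add: f_def)
    qed
  qed (auto intro: opn)
  also have "(\<Union>k. H k - {1}) = - {1}" using K by blast
  finally have 1: "f holomorphic_on - {1}" .
  have 2: "(\<lambda>n. 1 / of_nat (Suc n) powr s) sums f s" if "Re s > 1" for s
  proof -
    have "s \<noteq> 1" using that by auto
    then have "f s = dirichlet_zeta s" unfolding f_def h(2)[OF that] by simp
    then show ?thesis
      unfolding dirichlet_zeta_def using dirichlet_zeta(2)[OF that] by (simp add: summable_sums)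
  qed
  show ?thesis using 1 2 by blast
qed

lemma
  shows riemann_zeta_holomorphic: "riemann_zeta holomorphic_on (- {1})"
    and riemann_zeta_sums:
      "\<And>s. Re s > 1 \<Longrightarrow> (\<lambda>n. 1 / of_nat (Suc n) powr s) sums riemann_zeta s"
  using someI_ex[OF riemann_zeta_exists, folded riemann_zeta_def] by simp_all

lemma riemann_zeta_unique:
  assumes "f holomorphic_on (- {1})"
    and "\<And>s. Re s > 1 \<Longrightarrow> (\<lambda>n. 1 / of_nat (Suc n) powr s) sums f s"
    and "s \<noteq> 1"
  shows "f s = riemann_zeta s"
proof (rule analytic_continuation_open[of "{s. Re s > 1}" "- {1}" f riemann_zeta s])
  show "{s. Re s > 1} \<noteq> {}" by (auto intro!: exI[of _ 2])
  show "connected (- {1::complex})"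
    by (intro connected_punctured_universe) simp
  show "f z = riemann_zeta z" if "z \<in> {s. Re s > 1}" for z
    using sums_unique2 assms(2) riemann_zeta_sums that by blast
qed (use assms riemann_zeta_holomorphic open_right_halfplane in auto)

lemma of_real_zeta_real:
  assumes "x \<noteq> 1"
  shows "of_real (zeta_real x) = riemann_zeta (of_real x)"
proof -
  have "(cnj \<circ> riemann_zeta \<circ> cnj) (of_real x) = riemann_zeta (of_real x)"
  proof (rule riemann_zeta_unique)
    have "cnj ` (- {1}) = - {1}"
    proof -
      have "x \<in> cnj ` (- {1})" if "x \<noteq> 1" for x
        using that by (intro image_eqI[of _ _ "cnj x"]) auto
      then show ?thesis by auto
    qed
    then show "(cnj \<circ> riemann_zeta \<circ> cnj) holomorphic_on - {1}"
      using riemann_zeta_holomorphic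
      by (intro holomorphic_on_compose_cnj_cnj) auto
    fix s :: complex assume s: "Re s > 1"
    have "(\<lambda>n. cnj (1 / of_nat (Suc n) powr cnj s)) sums cnj (riemann_zeta (cnj s))"
      using s by (subst sums_cnj) (intro riemann_zeta_sums, simp)
    moreover have "cnj (of_nat (Suc n) powr cnj s) = of_nat (Suc n) powr s" for n
      by (subst cnj_powr) (auto simp del: of_nat_Suc)
    ultimately show "(\<lambda>n. 1 / of_nat (Suc n) powr s) sums (cnj \<circ> riemann_zeta \<circ> cnj) s"
      by (simp del: of_nat_Suc)
  qed (use assms in auto)
  then have "cnj (riemann_zeta (of_real x)) = riemann_zeta (of_real x)" by simp
  then show ?thesis
    by (simp add: zeta_real_def complex_eq_iff)
qed

end

theory Submission
  imports Defs
begin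

text \<open>
  Write w = jk(j+k)/2 and r = exp(-wt). By independence
  |phi(theta)|^2 is the product over all pairs (j,k) of 1 / (1 + 2r(1 - cos(w theta)) / (1 - r)^2).

  Upper bound: the factors with k = 1 suffice. There w is the triangular number w_j = j(j+1)/2,
  and w_{j+h} - 2w_j + w_{j-h} = h^2. If h is about theta^(-1/2), then h^2 theta lies in [1,4], so
  the three angles w_{j+h} theta, w_j theta, w_{j-h} theta cannot all be close to multiples
  of 2 pi. When theta \<ge> ct this forces the sum of 1 - cos(w_j theta) over j up to a multiple of
  t^(-1/2), where r stays away from 0, to be at least of order t^(-1/2), that is n^(3/10).

  The condition theta \<ge> ct needs no computation of the variance: the same product gives
  |phi(theta)|^2 \<ge> exp(-C theta^2 t^(-8/3)), and comparing this with the hypothesis on D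
  at u = D n^(1/5) bounds D n^(1/5) / sigma_n from below by a multiple of t_n.
\<close>

section \<open>Upper and lower bounds for a single geometric factor\<close>

lemma cmod_geometric_cf_sq:
  assumes "0 < r" "r < 1"
  shows "(cmod ((1 - of_real r) / (1 - of_real r * cis a)))\<^sup>2 = 1 / (1 + 2 * r * (1 - cos a) / (1 - r)\<^sup>2)"
proof -
  have "(cmod (1 - of_real r * cis a))\<^sup>2 = (1 - r * cos a)\<^sup>2 + (r * sin a)\<^sup>2"
    by (simp add: cmod_power2)
  also have "\<dots> = 1 - 2 * r * cos a + r\<^sup>2 * ((sin a)\<^sup>2 + (cos a)\<^sup>2)"
    by algebra
  also have "\<dots> = (1 - r)\<^sup>2 + 2 * r * (1 - cos a)"
    unfolding sin_cos_squared_add by (simp add: power2_eq_square algebra_simps)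
  finally have d: "(cmod (1 - of_real r * cis a))\<^sup>2 = (1 - r)\<^sup>2 + 2 * r * (1 - cos a)" .
  have "cmod (1 - of_real r) = 1 - r"
    using assms norm_of_real[of "1 - r", where 'a = complex] by simp
  then show ?thesis
    using assms unfolding norm_divide power_divide d by (simp add: field_simps)
qed

lemma one_minus_cos_le: "1 - cos x \<le> x\<^sup>2 / 2" for x :: real
proof -
  have "1 - cos x = 2 * (sin (x / 2))\<^sup>2"
    using cos_double_sin[of "x / 2"] by simp
  also have "(sin (x / 2))\<^sup>2 \<le> (x / 2)\<^sup>2"
    using abs_sin_x_le_abs_x[of "x / 2"] by (simp only: abs_le_square_iff)
  finally show ?thesis by (simp add: power_divide)
qed

text \<open>From 1 + x <= exp x one gets x <= (1 + x)(1 - exp(-x)), which removes the singular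
  denominator; (1 + x)^2 <= 16 exp(x/2) then costs half of the exponential decay. The result is
  uniform down to x near 0.\<close>

lemma bose_weight_le:
  fixes x :: real
  assumes "x > 0"
  shows "x\<^sup>2 * exp (- x) / (1 - exp (- x))\<^sup>2 \<le> 16 * exp (- x / 2)"
proof -
  have "1 + x \<le> exp x" by (rule exp_ge_add_one_self)
  then have "x \<le> (1 + x) * (1 - exp (- x))"
    using assms by (simp add: exp_minus field_simps)
  then have "x\<^sup>2 \<le> ((1 + x) * (1 - exp (- x)))\<^sup>2"
    using assms by (intro power_mono) auto
  moreover have "(1 + x)\<^sup>2 \<le> (4 * exp (x / 4))\<^sup>2"
    using assms exp_ge_add_one_self[of "x / 4"] by (intro power_mono; linarith)
  moreover have "(4 * exp (x / 4))\<^sup>2 = 16 * exp (x / 2)"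
    by (simp add: power_mult_distrib flip: exp_double)
  ultimately have "x\<^sup>2 \<le> 16 * exp (x / 2) * (1 - exp (- x))\<^sup>2"
    by (smt (verit) mult_right_mono power_mult_distrib zero_le_power2)
  then have "x\<^sup>2 * exp (- x) \<le> 16 * exp (x / 2) * (1 - exp (- x))\<^sup>2 * exp (- x)"
    by (intro mult_right_mono) auto
  also have "\<dots> = 16 * exp (- x / 2) * (1 - exp (- x))\<^sup>2"
    by (simp add: mult_exp_exp field_simps)
  finally show ?thesis
    using assms by (simp add: pos_divide_le_eq)
qed

text \<open>Combines 1 - cos a <= a^2/2 with 1/(1 + y) >= exp(-y). Writing theta w = (theta/t)(wt)
  isolates the quantity controlled by \<open>bose_weight_le\<close>, so the exponents can later be
  summed over all pairs.\<close>

lemma cmod_geometric_cf_sq_ge: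
  assumes "w > 0" "t > 0"
  defines "r \<equiv> exp (- (w * t))"
  shows "(cmod ((1 - of_real r) / (1 - of_real r * cis (\<theta> * w))))\<^sup>2
           \<ge> exp (- (16 * \<theta>\<^sup>2 / t\<^sup>2 * exp (- (w * t / 2))))"
proof -
  define y where "y = 2 * r * (1 - cos (\<theta> * w)) / (1 - r)\<^sup>2"
  have r: "0 < r" "r < 1" using assms by (auto simp: r_def)
  have y0: "y \<ge> 0" using r by (simp add: y_def)
  have "y \<le> 2 * r * ((\<theta> * w)\<^sup>2 / 2) / (1 - r)\<^sup>2"
    unfolding y_def using r one_minus_cos_le[of "\<theta> * w"]
    by (intro divide_right_mono mult_left_mono) auto
  also have "\<dots> = \<theta>\<^sup>2 / t\<^sup>2 * ((w * t)\<^sup>2 * exp (- (w * t)) / (1 - exp (- (w * t)))\<^sup>2)"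
    using assms by (simp add: r_def power_mult_distrib)
  also have "\<dots> \<le> \<theta>\<^sup>2 / t\<^sup>2 * (16 * exp (- (w * t) / 2))"
    using assms by (intro mult_left_mono bose_weight_le) auto
  finally have y: "y \<le> 16 * \<theta>\<^sup>2 / t\<^sup>2 * exp (- (w * t / 2))" by (simp add: mult_ac)
  have "1 + y \<le> exp y" by (rule exp_ge_add_one_self)
  then have "exp (- y) \<le> 1 / (1 + y)"
    using y0 by (simp add: exp_minus field_simps)
  with y show ?thesis
    unfolding cmod_geometric_cf_sq[OF r] y_def[symmetric]
    by (meson dual_order.trans exp_le_cancel_iff neg_le_iff_le)
qed

text \<open>The denominator (1 - r)^2 is at most 1 and may be dropped. What remains is at least y =
  2 \<rho> (1 - cos a), which lies in [0,4], so that 1/(1 + y) = 1 - y/(1 + y) <= exp(-y/5). A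
  common \<open>\<rho>\<close> gives many factors the same constant.\<close>

lemma cmod_geometric_cf_sq_le:
  assumes "0 < \<rho>" "\<rho> \<le> r" "r < 1"
  shows "(cmod ((1 - of_real r) / (1 - of_real r * cis a)))\<^sup>2 \<le> exp (- (2 * \<rho> / 5 * (1 - cos a)))"
proof -
  define y where "y = 2 * \<rho> * (1 - cos a)"
  have c: "0 \<le> 1 - cos a" "1 - cos a \<le> 2" using cos_ge_minus_one[of a] by auto
  have y0: "y \<ge> 0" using assms c by (simp add: y_def)
  have y4: "y \<le> 4"
    using mult_mono[of "2 * \<rho>" 2 "1 - cos a" 2] c assms by (simp add: y_def)
  have "y \<le> 2 * r * (1 - cos a)"
    unfolding y_def using assms c by (intro mult_right_mono) auto
  also have "\<dots> \<le> 2 * r * (1 - cos a) / (1 - r)\<^sup>2"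
  proof -
    have "(1 - r)\<^sup>2 \<le> 1" using assms by (simp add: power_le_one)
    moreover have "0 < (1 - r)\<^sup>2" using assms by simp
    ultimately show ?thesis
      using c assms mult_left_le[of "(1 - r)\<^sup>2" "2 * r * (1 - cos a)"]
      by (simp add: pos_le_divide_eq)
  qed
  finally have "1 / (1 + 2 * r * (1 - cos a) / (1 - r)\<^sup>2) \<le> 1 / (1 + y)"
    using y0 by (intro divide_left_mono) auto
  also have "1 / (1 + y) = 1 + - (y / (1 + y))"
    using y0 by (simp add: field_simps)
  also have "\<dots> \<le> exp (- (y / (1 + y)))" by (rule exp_ge_add_one_self)
  also have "\<dots> \<le> exp (- (y / 5))"
    unfolding exp_le_cancel_iff neg_le_iff_le using y0 y4 by (intro divide_left_mono) auto
  finally show ?thesis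
    using assms by (subst cmod_geometric_cf_sq) (auto simp: y_def)
qed

lemma cmod_geometric_cf_le_1:
  assumes "0 < r" "r < 1"
  shows "cmod ((1 - of_real r) / (1 - of_real r * cis a)) \<le> 1"
proof -
  have "(cmod ((1 - of_real r) / (1 - of_real r * cis a)))\<^sup>2 \<le> exp (- (2 * r / 5 * (1 - cos a)))"
    using assms by (intro cmod_geometric_cf_sq_le) auto
  also have "\<dots> \<le> 1" using assms by simp
  finally show ?thesis by (simp add: power_le_one_iff)
qed

section \<open>Exponential sums over the weights\<close>

lemma sum_inverse_square_tail_le:
  fixes M N :: nat
  assumes "M \<ge> 1"
  shows "(\<Sum>j\<in>{M<..N}. 1 / (real j)\<^sup>2) \<le> 1 / real M"
proof (cases "M \<le> N")
  case True
  \<comment> \<open>Subtracting 1/N makes the claim inductive: the new term 1/(n+1)^2 is at most 1/n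
    - 1/(n+1).\<close>
  then have "(\<Sum>j\<in>{M<..N}. 1 / (real j)\<^sup>2) \<le> 1 / real M - 1 / real N"
  proof (induction N rule: dec_induct)
    case (step n)
    have "{M<..Suc n} = insert (Suc n) {M<..n}" using step by auto
    moreover have "1 / (real (Suc n))\<^sup>2 \<le> 1 / (real n * real (Suc n))"
      using step assms unfolding power2_eq_square by (intro divide_left_mono mult_mono) auto
    moreover have "1 / (real n * real (Suc n)) = 1 / real n - 1 / real (Suc n)"
      using step assms by (simp add: field_simps)
    ultimately show ?case using step by simp
  qed simp
  also have "\<dots> \<le> 1 / real M" by simp
  finally show ?thesis .
qed simp

text \<open>The full geometric series equals 1/(exp a - 1), and exp a - 1 >= a.\<close>

lemma sum_exp_le:
  fixes a :: real
  assumes "a > 0"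
  shows "(\<Sum>k=1..n. exp (- (a * real k))) \<le> 1 / a"
proof -
  have x: "0 < exp (- a)" "exp (- a) < 1" using assms by auto
  have "(\<Sum>k=1..n. exp (- (a * real k))) = exp (- a) * (\<Sum>k<n. exp (- a) ^ k)"
    unfolding sum_distrib_left
    by (rule sum.reindex_bij_witness[of _ Suc "\<lambda>k. k - 1"])
       (auto simp: mult_exp_exp algebra_simps simp flip: exp_of_nat_mult power_Suc)
  also have "(\<Sum>k<n. exp (- a) ^ k) \<le> 1 / (1 - exp (- a))"
    using x by (simp add: sum_gp_strict divide_right_mono)
  also have "exp (- a) * (1 / (1 - exp (- a))) \<le> 1 / a"
    using assms exp_ge_add_one_self[of a] by (simp add: exp_minus field_simps)
  finally show ?thesis using x by simp
qed

lemma sum_exp_weight_le: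
  fixes t :: real
  assumes t: "0 < t" "t \<le> 1" and F: "finite F" "F \<subseteq> pos_pairs"
  shows "(\<Sum>p\<in>F. exp (- (weight (fst p) (snd p) * t / 2))) \<le> 12 * t powr (- 2 / 3)"
proof -
  \<comment> \<open>Pairs with both entries at most \<open>M\<close> are counted trivially; otherwise the smaller
    entry is summed as a geometric series. The two contributions balance at M of order t^(-1/3).\<close>
  define g where "g p = exp (- (weight (fst p) (snd p) * t / 2))" for p
  define M where "M = nat \<lceil>t powr (- 1 / 3)\<rceil>"
  have p1: "t powr (- 1 / 3) \<ge> 1" using powr_mono'[of "-1/3" 0 t] t by simp
  have M: "t powr (- 1 / 3) \<le> real M" "real M \<le> 2 * t powr (- 1 / 3)"
    using p1 by (auto simp: M_def) linarith
  have M1: "M \<ge> 1" using p1 M by linarith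
  have "finite (fst ` F \<union> snd ` F)" using F by simp
  \<comment> \<open>A cutoff for the finite set \<open>F\<close>; none of the estimates below
    depends on it.\<close>
  then obtain N where N: "\<And>x. x \<in> fst ` F \<union> snd ` F \<Longrightarrow> x \<le> N"
    by (meson finite_nat_set_iff_bounded_le)
  define A where "A = {1..M} \<times> {1..M}"
  define B where "B = {M<..N} \<times> {1..N}"
  define B' where "B' = {1..N} \<times> {M<..N}"
  have sub: "F \<subseteq> A \<union> (B \<union> B')"
  proof
    fix p assume p: "p \<in> F"
    then have "fst p \<le> N" "snd p \<le> N" "1 \<le> fst p" "1 \<le> snd p"
      using N F(2) by (auto simp: pos_pairs_def)
    then show "p \<in> A \<union> (B \<union> B')" by (cases p) (auto simp: A_def B_def B'_def)
  qed
  have g0: "g p \<ge> 0" for p by (simp add: g_def)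
  have fin: "finite A" "finite B" "finite B'" by (auto simp: A_def B_def B'_def)
  have "sum g F \<le> sum g (A \<union> (B \<union> B'))"
    using sub g0 fin by (intro sum_mono2) auto
  also have "\<dots> \<le> sum g A + (sum g B + sum g B')"
    using fin g0 by (smt (verit) finite_UnI sum.union_inter sum_nonneg)
  finally have 1: "sum g F \<le> sum g A + (sum g B + sum g B')" .
  have "sum g A \<le> (\<Sum>p\<in>A. 1)"
    by (intro sum_mono) (use t in \<open>auto simp: g_def weight_def\<close>)
  also have "\<dots> = (real M)\<^sup>2" by (simp add: A_def power2_eq_square)
  also have "\<dots> \<le> (2 * t powr (- 1 / 3))\<^sup>2" using M by (intro power_mono) auto
  also have "\<dots> = 4 * t powr (- 2 / 3)"
    using t by (simp add: power_mult_distrib powr_power)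
  finally have A: "sum g A \<le> 4 * t powr (- 2 / 3)" .
  have sw: "sum g B' = sum g B"
    by (rule sum.reindex_bij_witness[of _ prod.swap prod.swap])
       (auto simp: B_def B'_def g_def weight_def algebra_simps)
  have "sum g B = (\<Sum>j\<in>{M<..N}. \<Sum>k=1..N. g (j, k))"
    by (simp add: B_def sum.cartesian_product)
  also have "\<dots> \<le> (\<Sum>j\<in>{M<..N}. 4 / t * (1 / (real j)\<^sup>2))"
  proof (intro sum_mono)
    fix j assume j: "j \<in> {M<..N}"
    then have a: "(real j)\<^sup>2 * t / 4 > 0" using t by auto
    have "(\<Sum>k=1..N. g (j, k)) \<le> (\<Sum>k=1..N. exp (- ((real j)\<^sup>2 * t / 4 * real k)))"
    proof (intro sum_mono)
      fix k
      \<comment> \<open>Replacing j + k by j bounds the weight below by j^2 k / 2, which is linear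
        in k, so the inner sum becomes geometric.\<close>
      have "real j * real k * real j * t \<le> real j * real k * (real j + real k) * t"
        using t by (intro mult_right_mono mult_left_mono) auto
      then show "g (j, k) \<le> exp (- ((real j)\<^sup>2 * t / 4 * real k))"
        by (simp add: g_def weight_def power2_eq_square algebra_simps)
    qed
    also have "\<dots> \<le> 1 / ((real j)\<^sup>2 * t / 4)" by (rule sum_exp_le[OF a])
    finally show "(\<Sum>k=1..N. g (j, k)) \<le> 4 / t * (1 / (real j)\<^sup>2)" by (simp add: field_simps)
  qed
  also have "\<dots> = 4 / t * (\<Sum>j\<in>{M<..N}. 1 / (real j)\<^sup>2)" by (simp add: sum_distrib_left)
  also have "\<dots> \<le> 4 / t * (1 / real M)"
    using t by (intro mult_left_mono sum_inverse_square_tail_le M1) auto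
  also have "\<dots> \<le> 4 / t * (1 / t powr (- 1 / 3))"
    using t M M1 by (intro mult_left_mono divide_left_mono mult_pos_pos) auto
  also have "\<dots> = 4 * t powr (- 2 / 3)"
  proof -
    have "t powr (- 2 / 3) * (t powr 1 * t powr (- 1 / 3)) = 1"
      using t unfolding powr_add[symmetric] by simp
    then show ?thesis using t by (simp add: field_simps)
  qed
  finally have B: "sum g B \<le> 4 * t powr (- 2 / 3)" .
  \<comment> \<open>The constant 12 is 4 from the square \<open>A\<close> plus 4 from each of the
    mirror images \<open>B\<close> and \<open>B'\<close>.\<close>
  show ?thesis using 1 A B sw by (simp add: g_def)
qed

section \<open>Second differences of the triangular numbers\<close>

lemma cmod_cis_minus_1_sq: "(cmod (cis a - 1))\<^sup>2 = 2 * (1 - cos a)"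
proof -
  have "(cmod (cis a - 1))\<^sup>2 = (cos a - 1)\<^sup>2 + (sin a)\<^sup>2" by (simp add: cmod_power2)
  also have "\<dots> = 2 - 2 * cos a"
    using sin_cos_squared_add[of a] by (simp add: power2_eq_square algebra_simps)
  finally show ?thesis by simp
qed

text \<open>The distance from cis a to 1 is subadditive in a and even, and its square is 2(1 - cos
  a). Squaring x + 2y + z by Cauchy-Schwarz with weights 1, 2, 1 produces the factor 4.\<close>

lemma one_minus_cos_second_difference_le:
  fixes a b c :: real
  shows "1 - cos (a - 2 * b + c) \<le> 4 * ((1 - cos a) + 2 * (1 - cos b) + (1 - cos c))"
proof -
  define x y z where "x = cmod (cis a - 1)" and "y = cmod (cis b - 1)" and "z = cmod (cis c - 1)"
  have mult: "cmod (cis (p + q) - 1) \<le> cmod (cis p - 1) + cmod (cis q - 1)" for p q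
  proof -
    have "cis (p + q) - 1 = cis p * (cis q - 1) + (cis p - 1)"
      by (simp add: cis_mult algebra_simps)
    then show ?thesis
      by (metis add.commute mult_1 norm_cis norm_mult norm_triangle_ineq)
  qed
  have neg: "cmod (cis (- b) - 1) = y"
    by (rule power2_eq_imp_eq) (auto simp: y_def cmod_cis_minus_1_sq)
  have eq: "a - 2 * b + c = (a + c) + (- b + - b)" by simp
  have "cmod (cis (a - 2 * b + c) - 1) \<le> x + 2 * y + z"
    using mult[of "a + c" "- b + - b"] mult[of a c] mult[of "- b" "- b"] neg
    unfolding eq x_def z_def by linarith
  then have "(cmod (cis (a - 2 * b + c) - 1))\<^sup>2 \<le> (x + 2 * y + z)\<^sup>2"
    by (intro power_mono) auto
  also have "\<dots> \<le> 4 * (x\<^sup>2 + 2 * y\<^sup>2 + z\<^sup>2)"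
  proof -
    \<comment> \<open>The Cauchy-Schwarz defect as an explicit sum of squares.\<close>
    have "4 * (x\<^sup>2 + 2 * y\<^sup>2 + z\<^sup>2) - (x + 2 * y + z)\<^sup>2 = 2 * (x - y)\<^sup>2 + 2 * (y - z)\<^sup>2 + (x - z)\<^sup>2"
      by (simp add: power2_eq_square algebra_simps)
    then show ?thesis by (smt (verit) zero_le_power2)
  qed
  finally show ?thesis
    by (simp add: x_def y_def z_def cmod_cis_minus_1_sq)
qed

lemma weight_1_second_difference:
  assumes "h \<le> j"
  shows "weight (j + h) 1 - 2 * weight j 1 + weight (j - h) 1 = (real h)\<^sup>2"
  using assms by (simp add: weight_def of_nat_diff power2_eq_square field_simps)

text \<open>The second difference h^2 does not depend on j, so the pointwise inequality can be
  summed over h < j <= J - h. There j - h, j and j + h all stay in 1..J, and each shifted sum is at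
  most the full one: 16 = 4 (1 + 2 + 1).\<close>

lemma sum_one_minus_cos_weight_ge:
  assumes h: "2 * h \<le> J"
  shows "(real J - 2 * real h) * (1 - cos ((real h)\<^sup>2 * \<theta>))
           \<le> 16 * (\<Sum>j=1..J. 1 - cos (\<theta> * weight j 1))"
proof -
  define f where "f j = 1 - cos (\<theta> * weight j 1)" for j
  define I where "I = {h<..J - h}"
  have f0: "f j \<ge> 0" for j by (simp add: f_def)
  have shift: "(\<Sum>j\<in>I. f (g j)) \<le> sum f {1..J}" if "inj_on g I" "g ` I \<subseteq> {1..J}" for g
    using that f0 by (simp add: sum.reindex[symmetric, unfolded o_def] sum_mono2)
  have "(real J - 2 * real h) * (1 - cos ((real h)\<^sup>2 * \<theta>)) = (\<Sum>j\<in>I. 1 - cos ((real h)\<^sup>2 * \<theta>))"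
    using h by (simp add: I_def of_nat_diff)
  also have "\<dots> \<le> (\<Sum>j\<in>I. 4 * (f (j + h) + 2 * f j + f (j - h)))"
  proof (intro sum_mono)
    fix j assume "j \<in> I"
    then have "(real h)\<^sup>2 * \<theta> = \<theta> * weight (j + h) 1 - 2 * (\<theta> * weight j 1) + \<theta> * weight (j - h) 1"
      unfolding I_def by (subst weight_1_second_difference[of h j, symmetric]) (auto simp: algebra_simps)
    then show "1 - cos ((real h)\<^sup>2 * \<theta>) \<le> 4 * (f (j + h) + 2 * f j + f (j - h))"
      unfolding f_def by (simp only: one_minus_cos_second_difference_le)
  qed
  also have "\<dots> = 4 * ((\<Sum>j\<in>I. f (j + h)) + 2 * (\<Sum>j\<in>I. f j) + (\<Sum>j\<in>I. f (j - h)))"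
    by (simp add: sum.distrib sum_distrib_left)
  also have "\<dots> \<le> 4 * (sum f {1..J} + 2 * sum f {1..J} + sum f {1..J})"
    by (intro mult_left_mono add_mono shift) (auto simp: I_def inj_on_def)
  finally show ?thesis by (simp add: f_def)
qed

lemma cos_le_cos_1:
  fixes x :: real
  assumes "1 \<le> x" "x \<le> 4"
  shows "cos x \<le> cos 1"
proof (cases "x \<le> pi")
  case True
  then show ?thesis using assms by (intro cos_monotone_0_pi_le) auto
next
  case False
  \<comment> \<open>Reflection at pi: as x <= 4 and pi > 3, the reflected point is still at least
    1.\<close>
  have "cos x = cos (2 * pi - x)" by simp
  also have "\<dots> \<le> cos 1"
    using False assms pi_gt3 by (intro cos_monotone_0_pi_le) auto
  finally show ?thesis .
qed

text \<open>The step h is adapted to theta so that h^2 theta lies in [1,4], away from multiples of 2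
  pi, whereas the range \<open>J\<close> depends only on the lower bound s. This makes the estimate
  uniform for theta in [s, pi].\<close>

lemma sum_one_minus_cos_weight_linear:
  fixes s \<theta> :: real
  assumes s: "0 < s" "s \<le> 1" and \<theta>: "s \<le> \<theta>" "\<theta> \<le> pi"
  defines "J \<equiv> nat \<lceil>5 * s powr (- 1 / 2)\<rceil>"
  shows "(1 - cos 1) / 16 * s powr (- 1 / 2) \<le> (\<Sum>j=1..J. 1 - cos (\<theta> * weight j 1))"
proof -
  define h where "h = nat \<lceil>\<theta> powr (- 1 / 2)\<rceil>"
  have s1: "s powr (- 1 / 2) \<ge> 1" using powr_mono'[of "-1/2" 0 s] s by simp
  have \<theta>s: "\<theta> powr (- 1 / 2) \<le> s powr (- 1 / 2)"
    using s \<theta> by (intro powr_mono2') auto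
  have \<theta>0: "\<theta> > 0" using s \<theta> by simp
  have pos: "\<theta> powr (- 1 / 2) > 0" using \<theta>0 by simp
  have h1: "\<theta> powr (- 1 / 2) \<le> real h" "real h \<le> \<theta> powr (- 1 / 2) + 1"
    using pos by (auto simp: h_def)
  have J: "5 * s powr (- 1 / 2) \<le> real J" by (simp add: J_def)
  \<comment> \<open>Here h <= s^(-1/2) + 1 <= 2 s^(-1/2), so of the 5 s^(-1/2) in \<open>J\<close>
    at least one s^(-1/2) survives.\<close>
  have Jh: "s powr (- 1 / 2) \<le> real J - 2 * real h" using h1 \<theta>s s1 J by linarith
  have sq: "(\<theta> powr (- 1 / 2))\<^sup>2 * \<theta> = 1"
  proof -
    have "(\<theta> powr (- 1 / 2))\<^sup>2 = \<theta> powr (- 1)" using \<theta>0 by (simp add: powr_power)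
    then show ?thesis using \<theta>0 by (simp add: powr_minus)
  qed
  have "1 \<le> (real h)\<^sup>2 * \<theta>"
    using sq mult_right_mono[OF power_mono[OF h1(1), of 2], of \<theta>] pos \<theta>0 by simp
  moreover have "(real h)\<^sup>2 * \<theta> \<le> 4"
  \<comment> \<open>For theta >= 1 rounding up gives h = 1, and theta <= pi < 4; for theta < 1
    rounding up at most doubles theta^(-1/2).\<close>
  proof (cases "\<theta> \<ge> 1")
    case True
    then have "\<theta> powr (- 1 / 2) \<le> 1" using powr_mono[of "-1/2" 0 \<theta>] by simp
    then have "h = 1" using pos unfolding h_def by linarith
    then show ?thesis using \<theta> pi_less_4 by simp
  next
    case False
    then have "1 \<le> \<theta> powr (- 1 / 2)" using powr_mono'[of "-1/2" 0 \<theta>] \<theta>0 by simp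
    then have "(real h)\<^sup>2 * \<theta> \<le> (2 * \<theta> powr (- 1 / 2))\<^sup>2 * \<theta>"
      using h1 \<theta>0 by (intro mult_right_mono power_mono) auto
    then show ?thesis using sq by (simp add: power_mult_distrib)
  qed
  ultimately have "cos ((real h)\<^sup>2 * \<theta>) \<le> cos 1" by (rule cos_le_cos_1)
  then have "s powr (- 1 / 2) * (1 - cos 1) \<le> (real J - 2 * real h) * (1 - cos ((real h)\<^sup>2 * \<theta>))"
    using Jh s1 by (intro mult_mono) auto
  also have "\<dots> \<le> 16 * (\<Sum>j=1..J. 1 - cos (\<theta> * weight j 1))"
    using Jh s1 by (intro sum_one_minus_cos_weight_ge) linarith
  finally show ?thesis by (simp add: field_simps)
qed

section \<open>The product formula for the characteristic function\<close>

text \<open>The default values agree: a divergent \<open>infsum\<close> is 0, and so is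
  \<open>enn2real\<close> of infinity. This form makes the measurability of \<open>sum_N\<close>
  evident.\<close>

lemma infsum_nonneg_eq_enn2real_suminf:
  fixes f :: "nat \<Rightarrow> real"
  assumes "\<And>n. f n \<ge> 0"
  shows "infsum f UNIV = enn2real (\<Sum>n. ennreal (f n))"
proof (cases "f summable_on UNIV")
  case True
  then have "f sums infsum f UNIV" by (intro has_sum_imp_sums has_sum_infsum)
  then have s: "summable f" "suminf f = infsum f UNIV"
    by (auto dest: sums_summable sums_unique)
  then have "(\<Sum>n. ennreal (f n)) = ennreal (infsum f UNIV)"
    using suminf_ennreal2[OF assms] by simp
  then show ?thesis using assms by (simp add: infsum_nonneg)
next
  case False
  then have "(\<Sum>n. ennreal (f n)) = top"
    using summable_on_UNIV_nonneg_real_iff[of f] summable_suminf_not_top[of f] assms by metis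
  then show ?thesis using False by (simp add: infsum_not_exists)
qed

text \<open>Under the law of \<open>Y\<close> the integral is the geometric series with ratio r cis
  a, of modulus r < 1.\<close>

lemma (in prob_space) geometric_cf:
  fixes Y :: "'a \<Rightarrow> nat"
  assumes r: "0 < r" "r < 1"
    and Y [measurable]: "Y \<in> M \<rightarrow>\<^sub>M count_space UNIV"
    and P: "\<And>m. prob {\<omega> \<in> space M. Y \<omega> = m} = (1 - r) * r ^ m"
  shows "(CLINT \<omega>|M. cis (a * real (Y \<omega>))) = (1 - of_real r) / (1 - of_real r * cis a)"
proof -
  have D: "distr M (count_space UNIV) Y = density (count_space UNIV) (\<lambda>m. ennreal ((1 - r) * r ^ m))"
  proof (rule measure_eqI_countable)
    fix m :: nat
    have "emeasure (distr M (count_space UNIV) Y) {m} = emeasure M {\<omega> \<in> space M. Y \<omega> = m}"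
      by (subst emeasure_distr) (auto intro!: arg_cong[where f = "emeasure M"])
    also have "\<dots> = ennreal ((1 - r) * r ^ m)" by (simp add: emeasure_eq_measure P)
    finally show "emeasure (distr M (count_space UNIV) Y) {m} =
        emeasure (density (count_space UNIV) (\<lambda>m. ennreal ((1 - r) * r ^ m))) {m}"
      by (simp add: emeasure_density)
  qed auto
  have "(CLINT \<omega>|M. cis (a * real (Y \<omega>))) = (CLINT m|distr M (count_space UNIV) Y. cis (a * real m))"
    by (subst integral_distr) auto
  also have "\<dots> = (CLINT m|count_space UNIV. ((1 - r) * r ^ m) *\<^sub>R cis (a * real m))"
    unfolding D using r by (subst integral_density) auto
  also have "(\<lambda>m. ((1 - r) * r ^ m) *\<^sub>R cis (a * real m)) = (\<lambda>m. (1 - of_real r) * (of_real r * cis a) ^ m)"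
    by (simp add: scaleR_conv_of_real power_mult_distrib Complex.DeMoivre mult.assoc mult.commute[of a])
  also have "(CLINT m|count_space UNIV. (1 - of_real r) * (of_real r * cis a) ^ m) =
      (\<Sum>m. (1 - of_real r) * (of_real r * cis a) ^ m)"
    using r by (intro integral_count_space_nat)
      (auto simp: integrable_count_space_nat_iff norm_mult norm_power intro!: summable_mult summable_geometric)
  also have "\<dots> = (1 - of_real r) * (1 / (1 - of_real r * cis a))"
    using r by (subst suminf_mult) (auto simp: norm_mult suminf_geometric intro!: summable_geometric)
  finally show ?thesis by simp
qed

text \<open>The characteristic function at theta of \<open>weight j k\<close> times the (j,k)
  variable, in closed form and hence free of the probability space.\<close>

definition weight_cf :: "real \<Rightarrow> real \<Rightarrow> nat \<times> nat \<Rightarrow> complex" where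
  "weight_cf t \<theta> = (\<lambda>(j, k). (1 - of_real (exp (- (weight j k * t)))) /
     (1 - of_real (exp (- (weight j k * t))) * cis (\<theta> * weight j k)))"

text \<open>An explicit ordering of the pairs turns the unordered sum into a limit along a sequence,
  as Borel-Cantelli and dominated convergence require.\<close>

definition enum_pairs :: "nat \<Rightarrow> nat \<times> nat" where
  "enum_pairs i = map_prod Suc Suc (prod_decode i)"

lemma bij_betw_enum_pairs: "bij_betw enum_pairs UNIV pos_pairs"
proof -
  have "bij_betw (map_prod Suc Suc) UNIV pos_pairs"
    by (rule bij_betw_byWitness[where f' = "map_prod (\<lambda>x. x - 1) (\<lambda>x. x - 1)"])
       (auto simp: pos_pairs_def)
  then show ?thesis
    unfolding enum_pairs_def by (rule bij_betw_trans[OF bij_prod_decode, unfolded o_def])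
qed

lemma enum_pairs_in [simp]: "enum_pairs i \<in> pos_pairs"
  using bij_betw_enum_pairs by (auto simp: bij_betw_def)

lemma inj_enum_pairs: "inj enum_pairs"
  using bij_betw_enum_pairs by (auto simp: bij_betw_def)

lemma weight_pos: "(j, k) \<in> pos_pairs \<Longrightarrow> weight j k > 0"
  by (auto simp: pos_pairs_def weight_def)

text \<open>By Borel-Cantelli almost surely only finitely many variables are nonzero, so the partial
  sums converge to \<open>sum_N\<close>. Dominated convergence with bound 1 passes to the limit, and
  independence factors each partial expectation.\<close>

lemma phi_LIMSEQ:
  assumes model: "geometric_model t M X" and t: "0 < t" "t \<le> 1"
  shows "(\<lambda>n. \<Prod>p\<in>enum_pairs ` {..<n}. weight_cf t \<theta> p) \<longlonglongrightarrow> phi M X \<theta>"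
proof -
  interpret prob_space M using model by (simp add: geometric_model_def)
  define Y where "Y p = X (fst p) (snd p)" for p
  define w where "w p = weight (fst p) (snd p)" for p
  have indep: "indep_vars (\<lambda>_. count_space UNIV) Y pos_pairs"
    using model by (simp add: geometric_model_def Y_def[abs_def] case_prod_beta')
  have wpos: "w p > 0" if "p \<in> pos_pairs" for p
    using weight_pos[of "fst p" "snd p"] that by (simp add: w_def)
  have meas: "Y p \<in> M \<rightarrow>\<^sub>M count_space UNIV" if "p \<in> pos_pairs" for p
    using indep that by (auto simp: indep_vars_def)
  note [measurable] = meas[OF enum_pairs_in]
  have P: "prob {\<omega> \<in> space M. Y p \<omega> = m} = (1 - exp (- (w p * t))) * exp (- (w p * t)) ^ m"
    if "p \<in> pos_pairs" for p m
    using model that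
    by (auto simp: geometric_model_def pos_pairs_def Y_def w_def mult_ac simp flip: exp_of_nat_mult)
  define N where "N \<omega> = (\<Sum>i. ennreal (w (enum_pairs i) * real (Y (enum_pairs i) \<omega>)))" for \<omega>
  have sumN: "sum_N X \<omega> = infsum (\<lambda>i. w (enum_pairs i) * real (Y (enum_pairs i) \<omega>)) UNIV" for \<omega>
    unfolding sum_N_def infsum_reindex_bij_betw[OF bij_betw_enum_pairs, symmetric]
    by (simp add: case_prod_beta' w_def Y_def)
  have "sum_N X \<omega> = enn2real (N \<omega>)" for \<omega>
    unfolding sumN N_def
    by (rule infsum_nonneg_eq_enn2real_suminf) (simp add: wpos less_imp_le)
  then have [measurable]: "sum_N X \<in> borel_measurable M"
    unfolding N_def by (subst measurable_cong[of M "sum_N X"]) auto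
  define S where "S n \<omega> = (\<Sum>i<n. w (enum_pairs i) * real (Y (enum_pairs i) \<omega>))" for n \<omega>
  have AE_fin: "AE \<omega> in M. \<forall>\<^sub>F i in sequentially. Y (enum_pairs i) \<omega> = 0"
  proof -
    have p: "prob {\<omega> \<in> space M. Y (enum_pairs i) \<omega> \<noteq> 0} = exp (- (w (enum_pairs i) * t))" for i
      using prob_neg[of "\<lambda>\<omega>. Y (enum_pairs i) \<omega> = 0"] P[OF enum_pairs_in, of i 0] by simp
    have "summable (\<lambda>i. exp (- (w (enum_pairs i) * t)))"
    proof (rule summableI_nonneg_bounded)
      fix n
      \<comment> \<open>The exponent is halved only to match the form of
        \<open>sum_exp_weight_le\<close>.\<close>
      have "(\<Sum>i<n. exp (- (w (enum_pairs i) * t))) \<le> (\<Sum>i<n. exp (- (w (enum_pairs i) * t / 2)))"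
        using t by (intro sum_mono) (auto simp: wpos less_imp_le)
      also have "\<dots> = (\<Sum>p\<in>enum_pairs ` {..<n}. exp (- (w p * t / 2)))"
        by (subst sum.reindex) (auto intro: inj_on_subset[OF inj_enum_pairs])
      also have "\<dots> \<le> 12 * t powr (- 2 / 3)"
        unfolding w_def using t by (intro sum_exp_weight_le) auto
      finally show "(\<Sum>i<n. exp (- (w (enum_pairs i) * t))) \<le> 12 * t powr (- 2 / 3)" .
    qed auto
    then have "AE \<omega> in M. \<forall>\<^sub>F i in sequentially. \<omega> \<in> space M - {\<omega> \<in> space M. Y (enum_pairs i) \<omega> \<noteq> 0}"
      by (intro borel_cantelli_AE1) (simp_all add: p emeasure_eq_measure del: neq0_conv)
    then show ?thesis
      by eventually_elim (auto elim!: eventually_mono)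
  qed
  have AE_lim: "AE \<omega> in M. (\<lambda>n. S n \<omega>) \<longlonglongrightarrow> sum_N X \<omega>"
    using AE_fin
  proof eventually_elim
    case (elim \<omega>)
    then obtain m where m: "\<And>i. i \<ge> m \<Longrightarrow> Y (enum_pairs i) \<omega> = 0"
      by (auto simp: eventually_sequentially)
    \<comment> \<open>With finitely many nonzero terms the infinite sum is a genuine partial sum, so
      the default value of \<open>infsum\<close> does not interfere.\<close>
    have "((\<lambda>i. w (enum_pairs i) * real (Y (enum_pairs i) \<omega>)) has_sum S m \<omega>) UNIV"
      by (rule has_sum_finite_neutralI[of "{..<m}"]) (auto simp: S_def m)
    then have "(\<lambda>i. w (enum_pairs i) * real (Y (enum_pairs i) \<omega>)) sums S m \<omega>" "sum_N X \<omega> = S m \<omega>"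
      unfolding sumN by (auto intro: has_sum_imp_sums infsumI)
    then show ?case by (simp add: sums_def S_def)
  qed
  have "(\<lambda>n. CLINT \<omega>|M. cis (\<theta> * S n \<omega>)) \<longlonglongrightarrow> (CLINT \<omega>|M. cis (\<theta> * sum_N X \<omega>))"
  proof (rule integral_dominated_convergence[where w = "\<lambda>_. 1"])
    show "(\<lambda>\<omega>. cis (\<theta> * S n \<omega>)) \<in> borel_measurable M" for n
      unfolding S_def cis_conv_exp by measurable
    show "(\<lambda>\<omega>. cis (\<theta> * sum_N X \<omega>)) \<in> borel_measurable M"
      unfolding cis_conv_exp by measurable
    show "AE \<omega> in M. (\<lambda>n. cis (\<theta> * S n \<omega>)) \<longlonglongrightarrow> cis (\<theta> * sum_N X \<omega>)"
      using AE_lim by eventually_elim (intro tendsto_intros)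
  qed auto
  moreover have "(CLINT \<omega>|M. cis (\<theta> * S n \<omega>)) = (\<Prod>p\<in>enum_pairs ` {..<n}. weight_cf t \<theta> p)" for n
  proof -
    let ?F = "enum_pairs ` {..<n}"
    have F: "?F \<subseteq> pos_pairs" by auto
    have "indep_vars (\<lambda>_. borel) (\<lambda>p \<omega>. cis (\<theta> * w p * real (Y p \<omega>))) ?F"
      by (rule indep_vars_compose2[OF indep_vars_subset[OF indep F]]) auto
    then have "(CLINT \<omega>|M. \<Prod>p\<in>?F. cis (\<theta> * w p * real (Y p \<omega>))) =
        (\<Prod>p\<in>?F. CLINT \<omega>|M. cis (\<theta> * w p * real (Y p \<omega>)))"
      using meas F
      by (intro indep_vars_lebesgue_integral)
         (auto intro!: integrable_const_bound[where B = 1] simp: measurable_compose[where M = M and N = "count_space UNIV"])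
    also have "\<dots> = (\<Prod>p\<in>?F. weight_cf t \<theta> p)"
    proof (rule prod.cong[OF refl])
      fix p assume "p \<in> ?F"
      then have p: "p \<in> pos_pairs" using F by blast
      show "(CLINT \<omega>|M. cis (\<theta> * w p * real (Y p \<omega>))) = weight_cf t \<theta> p"
        using wpos[OF p] t
        by (subst geometric_cf[OF _ _ meas[OF p] P[OF p]]) (auto simp: weight_cf_def w_def case_prod_beta')
    qed
    also have "(\<lambda>\<omega>. \<Prod>p\<in>?F. cis (\<theta> * w p * real (Y p \<omega>))) = (\<lambda>\<omega>. cis (\<theta> * S n \<omega>))"
    proof
      fix \<omega>
      have "S n \<omega> = (\<Sum>p\<in>?F. w p * real (Y p \<omega>))"
        unfolding S_def by (subst sum.reindex) (auto intro: inj_on_subset[OF inj_enum_pairs])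
      then show "(\<Prod>p\<in>?F. cis (\<theta> * w p * real (Y p \<omega>))) = cis (\<theta> * S n \<omega>)"
        by (simp add: cis_conv_exp sum_distrib_left mult.assoc flip: exp_sum)
    qed
    finally show ?thesis .
  qed
  moreover have "phi M X \<theta> = (CLINT \<omega>|M. cis (\<theta> * sum_N X \<omega>))"
    by (simp add: phi_def cis_conv_exp)
  ultimately show ?thesis by simp
qed

section \<open>Lower and upper bounds for the characteristic function\<close>

text \<open>The factorwise lower bounds multiply to an exponent 16 theta^2/t^2 times at most 12
  t^(-2/3), whence 192 and the power -8/3. The bound is the same for every finite set of pairs and
  so survives the limit.\<close>

lemma cmod_phi_sq_ge:
  assumes "geometric_model t M X" and t: "0 < t" "t \<le> 1"
  shows "exp (- (192 * \<theta>\<^sup>2 * t powr (- 8 / 3))) \<le> (cmod (phi M X \<theta>))\<^sup>2"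
proof (rule LIMSEQ_le_const)
  show "(\<lambda>n. (cmod (\<Prod>p\<in>enum_pairs ` {..<n}. weight_cf t \<theta> p))\<^sup>2) \<longlonglongrightarrow> (cmod (phi M X \<theta>))\<^sup>2"
    by (intro tendsto_intros phi_LIMSEQ assms)
  have "exp (- (192 * \<theta>\<^sup>2 * t powr (- 8 / 3))) \<le> (cmod (\<Prod>p\<in>F. weight_cf t \<theta> p))\<^sup>2"
    if F: "finite F" "F \<subseteq> pos_pairs" for F
  proof -
    have "t powr (- 8 / 3) = t powr (- 2 / 3) / t\<^sup>2"
      using t powr_diff[of t "- 2 / 3" 2] by simp
    then have "16 * \<theta>\<^sup>2 / t\<^sup>2 * (12 * t powr (- 2 / 3)) = 192 * \<theta>\<^sup>2 * t powr (- 8 / 3)" by simp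
    moreover have "16 * \<theta>\<^sup>2 / t\<^sup>2 * (\<Sum>p\<in>F. exp (- (weight (fst p) (snd p) * t / 2)))
        \<le> 16 * \<theta>\<^sup>2 / t\<^sup>2 * (12 * t powr (- 2 / 3))"
      using F t by (intro mult_left_mono sum_exp_weight_le) auto
    ultimately have "exp (- (192 * \<theta>\<^sup>2 * t powr (- 8 / 3))) \<le>
        exp (\<Sum>p\<in>F. - (16 * \<theta>\<^sup>2 / t\<^sup>2 * exp (- (weight (fst p) (snd p) * t / 2))))"
      unfolding exp_le_cancel_iff sum_negf neg_le_iff_le sum_distrib_left[symmetric] by simp
    also have "\<dots> = (\<Prod>p\<in>F. exp (- (16 * \<theta>\<^sup>2 / t\<^sup>2 * exp (- (weight (fst p) (snd p) * t / 2)))))"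
      using F by (simp add: exp_sum)
    also have "\<dots> \<le> (\<Prod>p\<in>F. (cmod (weight_cf t \<theta> p))\<^sup>2)"
    proof (intro prod_mono conjI)
      fix p assume "p \<in> F"
      then have "weight (fst p) (snd p) > 0"
        using F weight_pos[of "fst p" "snd p"] by auto
      then show "exp (- (16 * \<theta>\<^sup>2 / t\<^sup>2 * exp (- (weight (fst p) (snd p) * t / 2)))) \<le> (cmod (weight_cf t \<theta> p))\<^sup>2"
        unfolding weight_cf_def case_prod_beta' using t by (intro cmod_geometric_cf_sq_ge) auto
    qed auto
    also have "\<dots> = (cmod (\<Prod>p\<in>F. weight_cf t \<theta> p))\<^sup>2"
      by (simp add: prod_norm[symmetric] prod_power_distrib)
    finally show ?thesis .
  qed
  then show "\<exists>N. \<forall>n\<ge>N. exp (- (192 * \<theta>\<^sup>2 * t powr (- 8 / 3))) \<le>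
      (cmod (\<Prod>p\<in>enum_pairs ` {..<n}. weight_cf t \<theta> p))\<^sup>2"
    by (simp add: image_subset_iff)
qed

text \<open>Every factor has modulus at most 1, so once a partial product contains \<open>G\<close>
  the other factors can be discarded.\<close>

lemma cmod_phi_le_prod:
  assumes "geometric_model t M X" and t: "0 < t" "t \<le> 1"
    and G: "finite G" "G \<subseteq> pos_pairs"
  shows "cmod (phi M X \<theta>) \<le> (\<Prod>p\<in>G. cmod (weight_cf t \<theta> p))"
proof (rule LIMSEQ_le_const2)
  show "(\<lambda>n. cmod (\<Prod>p\<in>enum_pairs ` {..<n}. weight_cf t \<theta> p)) \<longlonglongrightarrow> cmod (phi M X \<theta>)"
    by (intro tendsto_intros phi_LIMSEQ assms)
  have le1: "cmod (weight_cf t \<theta> p) \<le> 1" if "p \<in> pos_pairs" for p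
    unfolding weight_cf_def case_prod_beta' using that t weight_pos[of "fst p" "snd p"]
    by (intro cmod_geometric_cf_le_1) auto
  have "finite (enum_pairs -` G)" using G inj_enum_pairs by (intro finite_vimageI)
  then obtain N where N: "enum_pairs -` G \<subseteq> {..<N}"
    by (auto simp: finite_nat_iff_bounded)
  have "cmod (\<Prod>p\<in>enum_pairs ` {..<n}. weight_cf t \<theta> p) \<le> (\<Prod>p\<in>G. cmod (weight_cf t \<theta> p))"
    if n: "n \<ge> N" for n
  proof -
    have "G \<subseteq> enum_pairs ` {..<n}"
    proof
      fix p assume p: "p \<in> G"
      then obtain i where i: "p = enum_pairs i"
        using G bij_betw_enum_pairs by (auto simp: bij_betw_def)
      then have "i < N" using N p by auto
      then show "p \<in> enum_pairs ` {..<n}" using i n by auto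
    qed
    then have "(\<Prod>p\<in>enum_pairs ` {..<n}. cmod (weight_cf t \<theta> p)) =
        (\<Prod>p\<in>enum_pairs ` {..<n} - G. cmod (weight_cf t \<theta> p)) * (\<Prod>p\<in>G. cmod (weight_cf t \<theta> p))"
      by (intro prod.subset_diff) auto
    also have "\<dots> \<le> 1 * (\<Prod>p\<in>G. cmod (weight_cf t \<theta> p))"
      by (intro mult_right_mono prod_le_1 prod_nonneg conjI le1) (auto simp del: split_paired_All)
    finally have "(\<Prod>p\<in>enum_pairs ` {..<n}. cmod (weight_cf t \<theta> p)) \<le> (\<Prod>p\<in>G. cmod (weight_cf t \<theta> p))"
      by simp
    then show ?thesis by (simp add: prod_norm)
  qed
  then show "\<exists>N. \<forall>n\<ge>N. cmod (\<Prod>p\<in>enum_pairs ` {..<n}. weight_cf t \<theta> p) \<le>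
      (\<Prod>p\<in>G. cmod (weight_cf t \<theta> p))" by blast
qed

text \<open>Only the pairs (j,1) with j <= \<open>J\<close> are kept, \<open>J\<close> being of
  order (ct)^(-1/2). On them wt <= 36/c, so r is at least \<open>\<rho>\<close>, and the linear
  lower bound for the cosine sum applies with s = ct. The constant 40 comes from 2/5 times
  1/16.\<close>

lemma cmod_phi_sq_le:
  assumes model: "geometric_model t M X" and t: "0 < t" "t \<le> 1" and c: "0 < c" "c \<le> 1"
    and \<theta>: "c * t \<le> \<bar>\<theta>\<bar>" "\<bar>\<theta>\<bar> \<le> pi"
  shows "(cmod (phi M X \<theta>))\<^sup>2 \<le> exp (- (exp (- (36 / c)) * (1 - cos 1) / 40 * t powr (- 1 / 2)))"
proof -
  define s where "s = c * t"
  define J where "J = nat \<lceil>5 * s powr (- 1 / 2)\<rceil>"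
  define \<rho> where "\<rho> = exp (- (36 / c))"
  define G where "G = (\<lambda>j. (j, 1::nat)) ` {1..J}"
  have s: "0 < s" "s \<le> t" "s \<le> 1"
    using t c mult_left_le[of c t] by (auto simp: s_def mult_le_one mult.commute)
  have s1: "1 \<le> s powr (- 1 / 2)" using powr_mono'[of "-1/2" 0 s] s by simp
  \<comment> \<open>Rounding up adds at most 1, which is at most s^(-1/2).\<close>
  have J: "real J \<le> 6 * s powr (- 1 / 2)" using s1 unfolding J_def by linarith
  have G: "finite G" "G \<subseteq> pos_pairs" by (auto simp: G_def pos_pairs_def)
  have factor: "(cmod (weight_cf t \<theta> (j, 1)))\<^sup>2 \<le> exp (- (2 * \<rho> / 5 * (1 - cos (\<bar>\<theta>\<bar> * weight j 1))))"
    if j: "j \<in> {1..J}" for j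
  proof -
    have w: "0 < weight j 1" using j by (intro weight_pos) (auto simp: pos_pairs_def)
    have "weight j 1 \<le> (real j)\<^sup>2"
      using j by (simp add: weight_def power2_eq_square field_simps)
    also have "\<dots> \<le> (6 * s powr (- 1 / 2))\<^sup>2" using j J by (intro power_mono) auto
    also have "\<dots> = 36 / s"
      using s by (simp add: power_mult_distrib powr_power powr_minus field_simps)
    finally have "weight j 1 * t \<le> 36 / s * t" using t by (intro mult_right_mono) auto
    also have "\<dots> = 36 / c" using t by (simp add: s_def)
    finally have "\<rho> \<le> exp (- (weight j 1 * t))" by (simp add: \<rho>_def)
    moreover have "cos (\<bar>\<theta>\<bar> * weight j 1) = cos (\<theta> * weight j 1)"
      by (simp add: abs_if)
    ultimately show ?thesis
      unfolding weight_cf_def using w t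
      by (simp only: prod.case) (intro cmod_geometric_cf_sq_le, auto simp: \<rho>_def)
  qed
  have "(cmod (phi M X \<theta>))\<^sup>2 \<le> (\<Prod>p\<in>G. cmod (weight_cf t \<theta> p))\<^sup>2"
    by (intro power_mono cmod_phi_le_prod[OF model t G]) auto
  also have "\<dots> = (\<Prod>j=1..J. (cmod (weight_cf t \<theta> (j, 1)))\<^sup>2)"
    unfolding G_def by (subst prod.reindex) (auto simp: inj_on_def prod_power_distrib)
  also have "\<dots> \<le> (\<Prod>j=1..J. exp (- (2 * \<rho> / 5 * (1 - cos (\<bar>\<theta>\<bar> * weight j 1)))))"
    using factor by (intro prod_mono) auto
  also have "\<dots> = exp (- (2 * \<rho> / 5 * (\<Sum>j=1..J. 1 - cos (\<bar>\<theta>\<bar> * weight j 1))))"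
    unfolding sum_distrib_left sum_negf[symmetric] by (simp only: exp_sum finite_atLeastAtMost)
  also have "\<dots> \<le> exp (- (2 * \<rho> / 5 * ((1 - cos 1) / 16 * t powr (- 1 / 2))))"
  proof -
    have "(1 - cos 1) / 16 * t powr (- 1 / 2) \<le> (1 - cos 1) / 16 * s powr (- 1 / 2)"
      using s by (intro mult_left_mono powr_mono2') auto
    also have "\<dots> \<le> (\<Sum>j=1..J. 1 - cos (\<bar>\<theta>\<bar> * weight j 1))"
      unfolding J_def using s \<theta> by (intro sum_one_minus_cos_weight_linear) (auto simp: s_def)
    finally show ?thesis
      unfolding exp_le_cancel_iff neg_le_iff_le by (intro mult_left_mono) (auto simp: \<rho>_def)
  qed
  also have "2 * \<rho> / 5 * ((1 - cos 1) / 16 * t powr (- 1 / 2)) = \<rho> * (1 - cos 1) / 40 * t powr (- 1 / 2)"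
    by (simp only: times_divide_eq_left times_divide_eq_right)
  finally show ?thesis by (simp only: \<rho>_def)
qed

section \<open>The size of the parameter t_n\<close>

lemma zeta_real_pos:
  assumes "x > 1"
  shows "zeta_real x > 0"
proof -
  have "(\<lambda>n. Re (1 / of_nat (Suc n) powr of_real x)) sums Re (riemann_zeta (of_real x))"
    using assms by (intro sums_Re riemann_zeta_sums) auto
  moreover have "Re (1 / of_nat (Suc n) powr of_real x) = 1 / real (Suc n) powr x" for n
  proof -
    have "complex_of_nat (Suc n) powr of_real x = of_real (real (Suc n) powr x)"
      by (subst powr_of_real[symmetric]) auto
    then have "1 / complex_of_nat (Suc n) powr of_real x = of_real (1 / real (Suc n) powr x)"
      by (simp only: of_real_divide of_real_1)
    then show ?thesis by (simp only: Re_complex_of_real)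
  qed
  ultimately have "(\<lambda>n. 1 / real (Suc n) powr x) sums zeta_real x"
    by (simp only: zeta_real_def)
  then have "summable (\<lambda>n. 1 / real (Suc n) powr x)" "zeta_real x = (\<Sum>n. 1 / real (Suc n) powr x)"
    by (rule sums_summable, rule sums_unique)
  then show ?thesis
    using suminf_pos[of "\<lambda>n. 1 / real (Suc n) powr x"] by simp
qed

lemma tau1_pos: "tau1 > 0"
proof -
  have "0 < 1 / 9 * Gamma (1 / 3 :: real) ^ 2 * zeta_real (5 / 3)"
    by (intro mult_pos_pos zero_less_power Gamma_real_pos zeta_real_pos) auto
  then have "0 < const_X"
    unfolding const_X_def powr_gt_zero by linarith
  then show ?thesis by (simp add: tau1_def)
qed

text \<open>With n^(-3/5) factored out, the corrections carry n^(-1/10) and n^(-1/5) and vanish in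
  the limit, so the positive \<open>tau1\<close> dominates.\<close>

lemma t_seq_asymp:
  "\<forall>\<^sub>F n in sequentially. tau1 / 2 * real n powr (- 3 / 5) \<le> t_seq n \<and>
     t_seq n \<le> 2 * tau1 * real n powr (- 3 / 5)"
proof -
  have "(\<lambda>n. real n powr a) \<longlonglongrightarrow> 0" if "a < 0" for a
    using that by (intro tendsto_neg_powr filterlim_real_sequentially)
  then have "(\<lambda>n. tau1 - tau2 * real n powr (- 1 / 10) - tau3 * real n powr (- 1 / 5))
      \<longlonglongrightarrow> tau1 - tau2 * 0 - tau3 * 0"
    by (intro tendsto_intros) auto
  then have lim: "(\<lambda>n. tau1 - tau2 * real n powr (- 1 / 10) - tau3 * real n powr (- 1 / 5)) \<longlonglongrightarrow> tau1"
    by simp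
  have "\<forall>\<^sub>F n in sequentially. tau1 / 2 < tau1 - tau2 * real n powr (- 1 / 10) - tau3 * real n powr (- 1 / 5)"
    "\<forall>\<^sub>F n in sequentially. tau1 - tau2 * real n powr (- 1 / 10) - tau3 * real n powr (- 1 / 5) < 2 * tau1"
    using order_tendstoD(1)[OF lim, of "tau1 / 2"] order_tendstoD(2)[OF lim, of "2 * tau1"] tau1_pos
    by linarith+
  then show ?thesis
  proof eventually_elim
    case (elim n)
    have "real n powr (- 1 / 10) * real n powr (- 3 / 5) = real n powr (- 7 / 10)"
      "real n powr (- 1 / 5) * real n powr (- 3 / 5) = real n powr (- 4 / 5)"
      unfolding powr_add[symmetric] by simp_all
    then have "t_seq n = (tau1 - tau2 * real n powr (- 1 / 10) - tau3 * real n powr (- 1 / 5)) * real n powr (- 3 / 5)"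
      unfolding t_seq_def left_diff_distrib mult.assoc by simp
    then show ?case
      using elim by (simp only:) (intro conjI mult_right_mono; (linarith | rule powr_ge_zero))
  qed
qed

lemma t_seq_LIMSEQ: "t_seq \<longlonglongrightarrow> 0"
proof -
  have "(\<lambda>n. real n powr a) \<longlonglongrightarrow> 0" if "a < 0" for a
    using that by (intro tendsto_neg_powr filterlim_real_sequentially)
  then have "t_seq \<longlonglongrightarrow> tau1 * 0 - tau2 * 0 - tau3 * 0"
    unfolding t_seq_def by (intro tendsto_intros) auto
  then show ?thesis by simp
qed

section \<open>Constants and the final comparison\<close>

theorem theorem10p1:
  fixes P :: "real \<Rightarrow> 'a measure"
    and X :: "nat \<Rightarrow> nat \<Rightarrow> 'a \<Rightarrow> nat"
    and D :: real
  assumes model: "\<And>t. t > 0 \<Longrightarrow> geometric_model t (P t) X"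
    and D_pos: "D > 0"
    and D_bound: "\<forall>\<^sub>F n in sequentially. \<forall>u::real. \<bar>u\<bar> \<le> D * real n powr (1 / 5) \<longrightarrow>
          cmod (phi (P (t_seq n)) X (u / sigma_seq P X n)) \<le> exp (- (u ^ 2) / 4)"
  shows "\<exists>E>0. \<forall>\<^sub>F n in sequentially. \<forall>u::real.
          D * real n powr (1 / 5) \<le> \<bar>u\<bar> \<and> \<bar>u\<bar> \<le> pi * sigma_seq P X n \<longrightarrow>
          cmod (phi (P (t_seq n)) X (u / sigma_seq P X n)) \<le> exp (- E * real n powr (3 / 10))"
proof -
  \<comment> \<open>The second entry is what the comparison at u = D n^(1/5) yields, with 20 an
    upper bound for sqrt 384; the minimum with 1 meets the hypothesis of
    \<open>cmod_phi_sq_le\<close>.\<close>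
  define c where "c = min 1 (D * (tau1 / 2) powr (1 / 3) / 20)"
  define K where "K = exp (- (36 / c)) * (1 - cos 1) / 40"
  \<comment> \<open>The factor (2 tau1)^(-1/2) converts t^(-1/2) into n^(3/10), and the final 1/2
    undoes the square of the modulus.\<close>
  define E where "E = K * (2 * tau1) powr (- 1 / 2) / 2"
  have c: "0 < c" "c \<le> 1" using D_pos tau1_pos by (auto simp: c_def)
  have "cos 1 < (1::real)" using cos_monotone_0_pi[of 0 1] pi_gt3 by simp
  then have K: "K > 0" by (simp add: K_def)
  then have E: "E > 0" using tau1_pos by (simp add: E_def)
  have "\<forall>\<^sub>F n in sequentially. t_seq n < 1"
    using order_tendstoD(2)[OF t_seq_LIMSEQ, of 1] by simp
  moreover have "\<forall>\<^sub>F n::nat in sequentially. n > 0"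
    by (rule eventually_gt_at_top)
  ultimately have "\<forall>\<^sub>F n in sequentially. \<forall>u::real.
          D * real n powr (1 / 5) \<le> \<bar>u\<bar> \<and> \<bar>u\<bar> \<le> pi * sigma_seq P X n \<longrightarrow>
          cmod (phi (P (t_seq n)) X (u / sigma_seq P X n)) \<le> exp (- E * real n powr (3 / 10))"
    using t_seq_asymp D_bound
  proof eventually_elim
    case (elim n)
    define t where "t = t_seq n"
    define \<sigma> where "\<sigma> = sigma_seq P X n"
    define u0 where "u0 = D * real n powr (1 / 5)"
    define \<phi> where "\<phi> = phi (P t) X"
    have t_lb: "tau1 / 2 * real n powr (- 3 / 5) \<le> t" and t_ub: "t \<le> 2 * tau1 * real n powr (- 3 / 5)"
      using elim by (auto simp: t_def)
    have "0 < tau1 / 2 * real n powr (- 3 / 5)" using tau1_pos elim by simp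
    then have t: "0 < t" "t \<le> 1" using t_lb elim by (auto simp: t_def)
    have u0: "u0 > 0" using D_pos elim by (simp add: u0_def)
    \<comment> \<open>The assumed Gaussian bound is taken at the endpoint \<open>u0\<close> and
      played against \<open>cmod_phi_sq_ge\<close> at the same point.\<close>
    have "cmod (\<phi> (u0 / \<sigma>)) \<le> exp (- (u0\<^sup>2) / 4)"
      using elim u0 unfolding \<phi>_def \<sigma>_def t_def u0_def by auto
    then have "(cmod (\<phi> (u0 / \<sigma>)))\<^sup>2 \<le> (exp (- (u0\<^sup>2) / 4))\<^sup>2" by (intro power_mono) auto
    moreover have "(exp (- (u0\<^sup>2) / 4))\<^sup>2 = exp (- (u0\<^sup>2 / 2))"
      by (simp flip: exp_double)
    moreover have "exp (- (192 * (u0 / \<sigma>)\<^sup>2 * t powr (- 8 / 3))) \<le> (cmod (\<phi> (u0 / \<sigma>)))\<^sup>2"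
      unfolding \<phi>_def using t by (intro cmod_phi_sq_ge model) auto
    ultimately have "exp (- (192 * (u0 / \<sigma>)\<^sup>2 * t powr (- 8 / 3))) \<le> exp (- (u0\<^sup>2 / 2))"
      by linarith
    \<comment> \<open>Comparing exponents bounds |u0 / \<sigma>| from below. This needs no case
      split at \<sigma> = 0, where the quotient is 0 by convention.\<close>
    then have "u0\<^sup>2 \<le> 384 * (u0 / \<sigma>)\<^sup>2 * t powr (- 8 / 3)" by simp
    then have "u0\<^sup>2 * t powr (8 / 3) \<le> 384 * (u0 / \<sigma>)\<^sup>2 * t powr (- 8 / 3) * t powr (8 / 3)"
      by (intro mult_right_mono) auto
    also have "\<dots> = 384 * (u0 / \<sigma>)\<^sup>2"
      using t by (simp add: mult.assoc flip: powr_add)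
    finally have low: "u0\<^sup>2 * t powr (8 / 3) \<le> 384 * (u0 / \<sigma>)\<^sup>2" .
    \<comment> \<open>Trades n^(2/5) for t^(-2/3) through the lower bound on t, so that
      \<open>u0\<close> squared times t^(8/3) dominates a multiple of t^2.\<close>
    have "((tau1 / 2) powr (1 / 3))\<^sup>2 = (tau1 / 2) powr (2 / 3)"
      using tau1_pos by (simp add: powr_power)
    also have "\<dots> = (tau1 / 2 * real n powr (- 3 / 5)) powr (2 / 3) * real n powr (2 / 5)"
      using tau1_pos elim by (simp add: powr_mult powr_powr powr_divide flip: powr_add)
    also have "\<dots> \<le> t powr (2 / 3) * real n powr (2 / 5)"
      using t_lb tau1_pos by (intro mult_right_mono powr_mono2) auto
    finally have a: "((tau1 / 2) powr (1 / 3))\<^sup>2 \<le> t powr (2 / 3) * real n powr (2 / 5)" .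
    have "(20 * c * t)\<^sup>2 \<le> (D * (tau1 / 2) powr (1 / 3) * t)\<^sup>2"
      using t c D_pos tau1_pos by (intro power_mono mult_right_mono) (auto simp: c_def)
    also have "\<dots> = D\<^sup>2 * t\<^sup>2 * ((tau1 / 2) powr (1 / 3))\<^sup>2"
      by (simp add: power_mult_distrib)
    also have "\<dots> \<le> D\<^sup>2 * t\<^sup>2 * (t powr (2 / 3) * real n powr (2 / 5))"
      by (intro mult_left_mono a) auto
    also have "\<dots> = u0\<^sup>2 * t powr (8 / 3)"
    proof -
      have "t\<^sup>2 * t powr (2 / 3) = t powr (8 / 3)"
        using t powr_add[of t 2 "2 / 3"] by simp
      moreover have "(real n powr (1 / 5))\<^sup>2 = real n powr (2 / 5)"
        using elim by (simp add: powr_power)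
      ultimately show ?thesis by (simp add: u0_def power_mult_distrib mult_ac)
    qed
    also have "\<dots> \<le> 400 * (u0 / \<sigma>)\<^sup>2" using low zero_le_power2[of "u0 / \<sigma>"] by linarith
    also have "\<dots> = (20 * (u0 / \<sigma>))\<^sup>2" unfolding power_mult_distrib by simp
    finally have "\<bar>20 * c * t\<bar> \<le> \<bar>20 * (u0 / \<sigma>)\<bar>" by (simp only: abs_le_square_iff)
    \<comment> \<open>The absolute value is kept because the sign of \<open>\<sigma>\<close> is not
      yet known; it becomes positive below from 0 < \<open>u0\<close> <= |u| <= pi \<sigma>.\<close>
    then have \<theta>0: "c * t \<le> u0 / \<bar>\<sigma>\<bar>" using c t u0 by (simp add: abs_mult)
    have "E * real n powr (3 / 10) = K * (2 * tau1 * real n powr (- 3 / 5)) powr (- 1 / 2) / 2"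
      using tau1_pos by (simp add: E_def powr_mult powr_powr)
    also have "\<dots> \<le> K * t powr (- 1 / 2) / 2"
      using t t_ub K by (intro divide_right_mono mult_left_mono powr_mono2') auto
    finally have EK: "E * real n powr (3 / 10) \<le> K * t powr (- 1 / 2) / 2" .
    have "cmod (\<phi> (u / \<sigma>)) \<le> exp (- E * real n powr (3 / 10))"
      if u: "u0 \<le> \<bar>u\<bar>" "\<bar>u\<bar> \<le> pi * \<sigma>" for u
    proof -
      have "0 < pi * \<sigma>" using u u0 by linarith
      then have \<sigma>: "\<sigma> > 0" by (simp add: zero_less_mult_iff)
      have "c * t \<le> u0 / \<sigma>" using \<theta>0 \<sigma> by simp
      also have "\<dots> \<le> \<bar>u / \<sigma>\<bar>" using u \<sigma> by (simp add: divide_right_mono)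
      \<comment> \<open>Both range conditions on the angle u / \<sigma> now hold: at least ct by the
        chain above, at most pi by the assumption on u.\<close>
      finally have "(cmod (\<phi> (u / \<sigma>)))\<^sup>2 \<le> exp (- (K * t powr (- 1 / 2)))"
        unfolding \<phi>_def K_def using t c u \<sigma>
        by (intro cmod_phi_sq_le model) (auto simp: pos_divide_le_eq)
      also have "\<dots> = (exp (- (K * t powr (- 1 / 2) / 2)))\<^sup>2"
        by (simp flip: exp_double)
      finally have "cmod (\<phi> (u / \<sigma>)) \<le> exp (- (K * t powr (- 1 / 2) / 2))"
        by (rule power2_le_imp_le) simp
      also have "\<dots> \<le> exp (- E * real n powr (3 / 10))" using EK by simp
      finally show ?thesis .
    qed
    then show ?case by (simp add: \<phi>_def \<sigma>_def t_def u0_def)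
  qed
  with E show ?thesis by blast
qed

end
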